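(* Let $K\ge 2$, $\alpha\in(0,1)$, and let $T=(t_{ij})$ be a $K\times K$ stochastic matrix of the block form $$T=\begin{bmatrix}1 & \mathbf{0}\\ r & Q\end{bmatrix},$$ where $r$ is a $(K-1)\times 1$ column vector with at least one positive entry and $Q$ is an irreducible $(K-1)\times(K-1)$ matrix. Let $(X[n],A[n])_{n\ge 0}$ be the Random Actions process with parameters $\alpha$ and $T$ whose agent $1$ is stubborn, i.e. $X_1[n]=0$ for all $n\ge 0$ (hence $A_1[n]=0$ with probability $1$ for all $n\ge0$), the remaining initial values $X_2[0],\dots,X_K[0]\in[0,1]$ being arbitrary. Then $X_k[n]\to 0$ in probability for every agent, i.e. for every $\varepsilon>0$, $$\lim_{n\to\infty}\mathbb{P}(X_k[n]>\varepsilon)=0\quad\text{for all }k\in\{1,2,\dots,K\}.$$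
   Context: A stochastic matrix is a square matrix with non-negative entries all of whose row sums equal $1$. Random Actions (RA) model with parameters $\alpha\in(0,1)$ and a $K\times K$ stochastic (trust) matrix $T$: $X[n]=(X_1[n],\dots,X_K[n])^T\in[0,1]^K$ and $A[n]=(A_1[n],\dots,A_K[n])^T\in\{0,1\}^K$ are random vectors for $n\ge 0$, with $X[0]\in[0,1]^K$ deterministic. At each time $n$, each agent $k$ chooses a random action $A_k[n]\sim\mathrm{Bernoulli}(X_k[n])$, i.e. $\mathbb{P}(A_k[n]=1\mid X[n])=X_k[n]$ and $\mathbb{P}(A_k[n]=0\mid X[n])=1-X_k[n]$. The probabilities are then updated by $$X[n+1]=(1-\alpha)X[n]+\alpha\,T A[n].$$ *)

theory Defs
  imports "HOL-Probability.Probability" "Jordan_Normal_Form.Matrix"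
begin

unbundle no vec_syntax

definition stochastic_mat :: "real mat \<Rightarrow> bool" where
  "stochastic_mat T \<longleftrightarrow> square_mat T
     \<and> (\<forall>i<dim_row T. \<forall>j<dim_row T. 0 \<le> T $$ (i, j))
     \<and> (\<forall>i<dim_row T. (\<Sum>j<dim_row T. T $$ (i, j)) = 1)"

text \<open>
  A square matrix is reducible if a simultaneous permutation of its rows and columns
  brings it into the block form \<open>[B, C; 0, D]\<close> with non-empty square diagonal blocks
  (\<open>B\<close> being of size \<open>m\<close>). With this convention every matrix of size one, including the
  zero matrix, is irreducible.
\<close>
definition reducible_mat :: "'a :: zero mat \<Rightarrow> bool" where
  "reducible_mat A \<longleftrightarrow>
     (\<exists>p m. p permutes {..<dim_row A} \<and> 0 < m \<and> m < dim_row A \<and>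
        (\<forall>i\<in>{m..<dim_row A}. \<forall>j<m. A $$ (p i, p j) = 0))"

definition irreducible_mat :: "'a :: zero mat \<Rightarrow> bool" where
  "irreducible_mat A \<longleftrightarrow> square_mat A \<and> \<not> reducible_mat A"

text \<open>
  The sub-\<open>\<sigma>\<close>-algebra generated by a random vector of dimension \<open>K\<close>. The type of vectors
  carries no topology, so the vector is passed to the product space as the family of its
  components.
\<close>
definition vec_sigma :: "'w measure \<Rightarrow> nat \<Rightarrow> ('w \<Rightarrow> real vec) \<Rightarrow> 'w measure" where
  "vec_sigma M K Y =
     vimage_algebra (space M) (\<lambda>\<omega>. \<lambda>k\<in>{..<K}. Y \<omega> $ k) (\<Pi>\<^sub>M k\<in>{..<K}. borel)"

lemma subalgebra_vec_sigma:
  assumes "\<And>k. k < K \<Longrightarrow> (\<lambda>\<omega>. Y \<omega> $ k) \<in> borel_measurable M"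
  shows "subalgebra M (vec_sigma M K Y)"
proof -
  have "(\<lambda>\<omega>. \<lambda>k\<in>{..<K}. Y \<omega> $ k) \<in> measurable M (\<Pi>\<^sub>M k\<in>{..<K}. borel)"
    using assms by (intro measurable_restrict) auto
  then show ?thesis
    unfolding subalgebra_def vec_sigma_def
    by (auto intro: sets_image_in_sets[THEN subsetD])
qed

text \<open>
  Agents are numbered from \<open>0\<close> to \<open>K - 1\<close>. The conditional probability of an event given
  \<open>X n\<close> is the conditional expectation of its indicator given the \<open>\<sigma>\<close>-algebra generated
  by \<open>X n\<close>; no assumption is made on the joint conditional law of the actions of
  different agents.
\<close>
locale random_actions = prob_space M for M :: "'w measure" +
  fixes K :: nat and \<alpha> :: real and T :: "real mat"
    and X A :: "nat \<Rightarrow> 'w \<Rightarrow> real vec"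
  assumes alpha: "0 < \<alpha>" "\<alpha> < 1"
    and T: "T \<in> carrier_mat K K" "stochastic_mat T"
    and X_dim: "\<And>n \<omega>. \<omega> \<in> space M \<Longrightarrow> X n \<omega> \<in> carrier_vec K"
    and A_dim: "\<And>n \<omega>. \<omega> \<in> space M \<Longrightarrow> A n \<omega> \<in> carrier_vec K"
    and X_measurable: "\<And>n k. k < K \<Longrightarrow> (\<lambda>\<omega>. X n \<omega> $ k) \<in> borel_measurable M"
    and A_measurable: "\<And>n k. k < K \<Longrightarrow> (\<lambda>\<omega>. A n \<omega> $ k) \<in> borel_measurable M"
    and X_range: "\<And>n k \<omega>. k < K \<Longrightarrow> \<omega> \<in> space M \<Longrightarrow> X n \<omega> $ k \<in> {0..1}"
    and A_range: "\<And>n k \<omega>. k < K \<Longrightarrow> \<omega> \<in> space M \<Longrightarrow> A n \<omega> $ k \<in> {0, 1}"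
    and X_init: "\<exists>x. \<forall>\<omega>\<in>space M. X 0 \<omega> = x"
    and action_1: "\<And>n k. k < K \<Longrightarrow> AE \<omega> in M.
       real_cond_exp M (vec_sigma M K (X n)) (indicat_real {\<omega> \<in> space M. A n \<omega> $ k = 1}) \<omega>
         = X n \<omega> $ k"
    and action_0: "\<And>n k. k < K \<Longrightarrow> AE \<omega> in M.
       real_cond_exp M (vec_sigma M K (X n)) (indicat_real {\<omega> \<in> space M. A n \<omega> $ k = 0}) \<omega>
         = 1 - X n \<omega> $ k"
    and update: "\<And>n. AE \<omega> in M.
       X (Suc n) \<omega> = (1 - \<alpha>) \<cdot>\<^sub>v X n \<omega> + \<alpha> \<cdot>\<^sub>v (T *\<^sub>v A n \<omega>)"

end

theory Submission
  imports Defs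
begin

text \<open>
  Taking expectations removes the randomness: \<open>m\<^sub>n = \<bbbE> X[n]\<close> obeys
  \<open>m\<^sub>n\<^sub>+\<^sub>1 = (1 - \<alpha>) m\<^sub>n + \<alpha> T m\<^sub>n\<close>. Hence the componentwise upper limit \<open>L\<close> of \<open>m\<^sub>n\<close> is
  subharmonic, \<open>L \<le> T L\<close>, so the set on which \<open>L\<close> is maximal is closed under the positive
  entries of \<open>T\<close>. By irreducibility of \<open>Q\<close> and \<open>r \<noteq> 0\<close> this set contains the stubborn agent,
  where \<open>L\<close> vanishes. So \<open>m\<^sub>n \<longlonglongrightarrow> 0\<close>, and Markov's inequality concludes.
\<close>

section \<open>Closed index sets and the maximum principle\<close>

text \<open>Listing the complement of \<open>S\<close> first and \<open>S\<close> last moves the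
  vanishing entries, with rows in \<open>S\<close> and columns outside \<open>S\<close>, to the
  lower left block.\<close>

lemma reducible_matI:
  assumes S: "S \<subseteq> {..<dim_row A}" "S \<noteq> {}" "S \<noteq> {..<dim_row A}"
    and zero: "\<And>i j. i \<in> S \<Longrightarrow> j < dim_row A \<Longrightarrow> j \<notin> S \<Longrightarrow> A $$ (i, j) = 0"
  shows "reducible_mat A"
proof -
  define n where "n = dim_row A"
  define m where "m = card ({..<n} - S)"
  have fS: "finite S" using S(1) finite_subset by blast
  have card_S: "m + card S = n"
    using S(1) fS card_Diff_subset[of S "{..<n}"] card_mono[of "{..<n}" S]
    by (simp add: m_def n_def)
  have "card S > 0" using S(2) fS by (simp add: card_gt_0_iff)
  moreover have "m > 0" using S(1,3) by (auto simp: m_def n_def card_gt_0_iff)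
  ultimately have m: "0 < m" "m < n" using card_S by auto
  obtain f where f: "bij_betw f {..<m} ({..<n} - S)"
    using ex_bij_betw_nat_finite[of "{..<n} - S"] by (auto simp: m_def atLeast0LessThan)
  obtain g where g: "bij_betw g {m..<n} S"
    using finite_same_card_bij[of "{m..<n}" S] fS card_S by auto
  \<comment> \<open>The value \<open>i\<close> beyond \<open>n\<close> is what
    \<open>permutes\<close> demands outside the index range.\<close>
  define p where "p i = (if i < m then f i else if i < n then g i else i)" for i
  have "bij_betw p {..<m} ({..<n} - S)"
    using f by (rule bij_betw_cong[THEN iffD1, rotated]) (simp add: p_def)
  moreover have pS: "bij_betw p {m..<n} S"
    using g by (rule bij_betw_cong[THEN iffD1, rotated]) (simp add: p_def)
  ultimately have "bij_betw p ({..<m} \<union> {m..<n}) (({..<n} - S) \<union> S)"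
    by (rule bij_betw_combine) auto
  moreover have "{..<m} \<union> {m..<n} = {..<n}" "({..<n} - S) \<union> S = {..<n}"
    using m S(1) by (auto simp: n_def)
  ultimately have "bij_betw p {..<n} {..<n}" by simp
  then have "p permutes {..<n}"
    by (rule bij_imp_permutes) (use m in \<open>auto simp: p_def\<close>)
  moreover have "A $$ (p i, p j) = 0" if "i \<in> {m..<n}" "j < m" for i j
  proof -
    have "p i \<in> S" using pS that(1) by (auto simp: bij_betw_def)
    moreover have "p j \<in> {..<n} - S" using f that(2) by (auto simp: bij_betw_def p_def)
    ultimately show ?thesis using zero by (auto simp: n_def)
  qed
  ultimately show ?thesis
    unfolding reducible_mat_def n_def[symmetric] using m by blast
qed

text \<open>A weighted mean of values at most \<open>c\<close> can reach \<open>c\<close> only if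
  every value of positive weight equals \<open>c\<close>: the weighted gaps
  \<open>t j * (c - L j)\<close> are non-negative and their sum is at most 0.\<close>

lemma subharmonic_max_closed:
  fixes L t :: "'i \<Rightarrow> real"
  assumes "finite I" and "\<And>j. j \<in> I \<Longrightarrow> 0 \<le> t j" and "(\<Sum>j\<in>I. t j) = 1"
    and "\<And>j. j \<in> I \<Longrightarrow> L j \<le> c" and "c \<le> (\<Sum>j\<in>I. t j * L j)"
    and "j \<in> I" and "t j > 0"
  shows "L j = c"
proof -
  have "(\<Sum>j\<in>I. t j * (c - L j)) = c - (\<Sum>j\<in>I. t j * L j)"
    using assms(3) by (simp add: right_diff_distrib sum_subtractf flip: sum_distrib_right)
  moreover have nonneg: "t j * (c - L j) \<ge> 0" if "j \<in> I" for j
    using assms(2,4)[OF that] by simp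
  ultimately have "(\<Sum>j\<in>I. t j * (c - L j)) = 0"
    using assms(5) sum_nonneg[of I "\<lambda>j. t j * (c - L j)"] by fastforce
  then have "t j * (c - L j) = 0"
    using sum_nonneg_eq_0_iff[of I "\<lambda>j. t j * (c - L j)"] nonneg assms(1,6) by blast
  with assms(7) show ?thesis by simp
qed

section \<open>Upper limits along the recursion\<close>

text \<open>The number \<open>l\<close> is the limes superior of \<open>u\<close>, obtained as the
  infimum of all eventual upper bounds. Boundedness keeps it real.\<close>

lemma bounded_upper_limit:
  fixes u :: "nat \<Rightarrow> real"
  assumes "\<And>n. u n \<in> {a..b}"
  obtains l where "\<And>e. e > 0 \<Longrightarrow> \<forall>\<^sub>F n in sequentially. u n \<le> l + e"
    and "\<And>v. \<forall>\<^sub>F n in sequentially. u n \<le> v \<Longrightarrow> l \<le> v"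
proof
  define V where "V = {v. \<forall>\<^sub>F n in sequentially. u n \<le> v}"
  have "b \<in> V" using assms by (simp add: V_def)
  \<comment> \<open>An eventual upper bound dominates at least one value of \<open>u\<close>, hence
    also \<open>a\<close>.\<close>
  have "a \<le> v" if "v \<in> V" for v
  proof -
    have "\<exists>n. u n \<le> v"
      using that eventually_happens'[OF sequentially_bot] by (auto simp: V_def)
    then show ?thesis using assms by (meson atLeastAtMost_iff order_trans)
  qed
  then have bdd: "bdd_below V" by (rule bdd_belowI)
  show "Inf V \<le> v" if "\<forall>\<^sub>F n in sequentially. u n \<le> v" for v
    using cInf_lower[OF _ bdd] that by (simp add: V_def)
  show "\<forall>\<^sub>F n in sequentially. u n \<le> Inf V + e" if "e > 0" for e
  proof -
    have "\<exists>v\<in>V. v < Inf V + e"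
      using \<open>b \<in> V\<close> that by (intro cInf_lessD) auto
    then show ?thesis unfolding V_def by (auto elim: eventually_mono)
  qed
qed

text \<open>Inserting the eventual bounds \<open>L j + e\<close> into the recursion bounds
  \<open>m (Suc n) k\<close>, and so \<open>L k\<close>, up to \<open>e\<close>. Letting
  \<open>e\<close> tend to 0, the term \<open>(1 - \<alpha>) * L k\<close> is absorbed on the left
  and \<alpha> cancels.\<close>

lemma upper_limit_subharmonic:
  fixes m :: "nat \<Rightarrow> nat \<Rightarrow> real" and t :: "nat \<Rightarrow> real"
  assumes alpha: "0 < \<alpha>" "\<alpha> < 1" and k: "k < K"
    and t: "\<And>j. j < K \<Longrightarrow> 0 \<le> t j" "(\<Sum>j<K. t j) = 1"
    and rec: "\<And>n. m (Suc n) k = (1 - \<alpha>) * m n k + \<alpha> * (\<Sum>j<K. t j * m n j)"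
    and upper: "\<And>j e. j < K \<Longrightarrow> e > 0 \<Longrightarrow> \<forall>\<^sub>F n in sequentially. m n j \<le> L j + e"
    and least: "\<And>v. \<forall>\<^sub>F n in sequentially. m n k \<le> v \<Longrightarrow> L k \<le> v"
  shows "L k \<le> (\<Sum>j<K. t j * L j)"
proof -
  have "L k \<le> (1 - \<alpha>) * L k + \<alpha> * (\<Sum>j<K. t j * L j) + e" if "e > 0" for e
  proof (rule least)
    have "\<forall>\<^sub>F n in sequentially. \<forall>j\<in>{..<K}. m n j \<le> L j + e"
      using upper that by (intro eventually_ball_finite) auto
    then have "\<forall>\<^sub>F n in sequentially.
        m (Suc n) k \<le> (1 - \<alpha>) * L k + \<alpha> * (\<Sum>j<K. t j * L j) + e"
    proof eventually_elim
      case (elim n)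
      have "(\<Sum>j<K. t j * m n j) \<le> (\<Sum>j<K. t j * (L j + e))"
        using elim t(1) by (intro sum_mono mult_left_mono) auto
      \<comment> \<open>Since the weights sum to 1, the error stays exactly
        \<open>e\<close>.\<close>
      also have "\<dots> = (\<Sum>j<K. t j * L j) + e"
        using t(2) by (simp add: distrib_left sum.distrib flip: sum_distrib_right)
      finally have "\<alpha> * (\<Sum>j<K. t j * m n j) \<le> \<alpha> * ((\<Sum>j<K. t j * L j) + e)"
        using alpha by simp
      moreover have "(1 - \<alpha>) * m n k \<le> (1 - \<alpha>) * (L k + e)"
        using elim k alpha by simp
      ultimately show ?case unfolding rec by (simp add: algebra_simps)
    qed
    then show "\<forall>\<^sub>F n in sequentially.
        m n k \<le> (1 - \<alpha>) * L k + \<alpha> * (\<Sum>j<K. t j * L j) + e"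
      by (subst (asm) eventually_sequentially_Suc)
  qed
  then have "L k \<le> (1 - \<alpha>) * L k + \<alpha> * (\<Sum>j<K. t j * L j)"
    by (rule field_le_epsilon)
  then have "\<alpha> * L k \<le> \<alpha> * (\<Sum>j<K. t j * L j)" by (simp add: algebra_simps)
  then show ?thesis using alpha by simp
qed

text \<open>A maximum principle with agent 0 as the boundary: a positive maximum would spread along
  positive entries of \<open>T\<close> to all other agents and then, through \<open>r\<close>, to
  agent 0.\<close>

lemma subharmonic_nonpos:
  fixes T r Q :: "real mat" and L :: "nat \<Rightarrow> real"
  assumes stoch: "stochastic_mat T"
    and r: "r \<in> carrier_mat N 1" and Q: "Q \<in> carrier_mat N N"
    and T: "T = four_block_mat (1\<^sub>m 1) (0\<^sub>m 1 N) r Q"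
    and pos: "\<exists>i<N. r $$ (i, 0) > 0"
    and irr: "irreducible_mat Q"
    and sub: "\<And>k. k < Suc N \<Longrightarrow> L k \<le> (\<Sum>j<Suc N. T $$ (k, j) * L j)"
    and zero: "L 0 \<le> 0" and k: "k < Suc N"
  shows "L k \<le> 0"
proof (rule ccontr)
  assume "\<not> L k \<le> 0"
  define c where "c = Max (L ` {..<Suc N})"
  have le_c: "L j \<le> c" if "j < Suc N" for j using that by (simp add: c_def)
  have c_pos: "c > 0" using le_c[OF k] \<open>\<not> L k \<le> 0\<close> by simp
  have dim: "dim_row T = Suc N" using T r Q by simp
  have t: "\<And>i j. i < Suc N \<Longrightarrow> j < Suc N \<Longrightarrow> 0 \<le> T $$ (i, j)"
    "\<And>i. i < Suc N \<Longrightarrow> (\<Sum>j<Suc N. T $$ (i, j)) = 1"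
    using stoch unfolding stochastic_mat_def dim by auto
  have closed: "L j = c" if "i < Suc N" "L i = c" "j < Suc N" "T $$ (i, j) > 0" for i j
    by (rule subharmonic_max_closed[where I = "{..<Suc N}" and t = "\<lambda>j. T $$ (i, j)"])
      (use that t le_c sub[of i] in auto)
  have entries: "T $$ (Suc i, 0) = r $$ (i, 0)" "j < N \<Longrightarrow> T $$ (Suc i, Suc j) = Q $$ (i, j)"
    if "i < N" for i j
    using that r Q by (auto simp: T)
  \<comment> \<open>Index \<open>i\<close> of \<open>r\<close> and \<open>Q\<close> stands for agent
    \<open>Suc i\<close>, hence the shift.\<close>
  define S where "S = {i. i < N \<and> L (Suc i) = c}"
  have "c \<in> L ` {..<Suc N}" unfolding c_def by (intro Max_in) auto
  then obtain i0 where i0: "i0 < Suc N" "L i0 = c" by auto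
  have "i0 \<noteq> 0" using i0(2) zero c_pos by (metis not_le)
  then have "i0 - 1 \<in> S" using i0 by (cases i0) (auto simp: S_def)
  \<comment> \<open>A positive entry would put \<open>j\<close> into \<open>S\<close> by
    \<open>closed\<close>, and entries are non-negative.\<close>
  moreover have "Q $$ (i, j) = 0" if "i \<in> S" "j < N" "j \<notin> S" for i j
  proof -
    have "\<not> T $$ (Suc i, Suc j) > 0" using that closed[of "Suc i" "Suc j"] by (auto simp: S_def)
    then show ?thesis using that t(1)[of "Suc i" "Suc j"] entries by (fastforce simp: S_def)
  qed
  \<comment> \<open>A non-empty proper \<open>S\<close> would make \<open>Q\<close>
    reducible.\<close>
  ultimately have "S = {..<N}"
    using reducible_matI[of S Q] irr Q by (auto simp: irreducible_mat_def S_def)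
  moreover obtain i where "i < N" "r $$ (i, 0) > 0" using pos by blast
  ultimately have "L 0 = c"
    using closed[of "Suc i" 0] entries by (auto simp: S_def)
  then show False using zero c_pos by simp
qed

section \<open>Expectations of the Random Actions process\<close>

context random_actions
begin

lemma integrable_X:
  assumes "k < K"
  shows "integrable M (\<lambda>\<omega>. X n \<omega> $ k)"
  using X_range[OF assms] X_measurable[OF assms]
  by (intro integrable_const_bound[where B = 1] AE_I2) auto

lemma integrable_A:
  assumes "k < K"
  shows "integrable M (\<lambda>\<omega>. A n \<omega> $ k)"
proof (rule integrable_const_bound[where B = 1, OF AE_I2])
  show "norm (A n \<omega> $ k) \<le> 1" if "\<omega> \<in> space M" for \<omega>
    using A_range[OF assms that, of n] by auto
qed (rule A_measurable[OF assms])

text \<open>The action is the indicator of the event that it equals 1, whose conditional probability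
  given \<open>X n\<close> is \<open>X n \<omega> $ k\<close>; averaging the conditional expectation
  gives the claim.\<close>

lemma expectation_A:
  assumes k: "k < K"
  shows "expectation (\<lambda>\<omega>. A n \<omega> $ k) = expectation (\<lambda>\<omega>. X n \<omega> $ k)"
proof -
  let ?F = "vec_sigma M K (X n)" and ?E = "{\<omega> \<in> space M. A n \<omega> $ k = 1}"
  interpret F: finite_measure_subalgebra M ?F
    by unfold_locales (intro subalgebra_vec_sigma X_measurable)
  have E: "?E \<in> sets M" using A_measurable[OF k] by measurable
  then have "integrable M (indicat_real ?E)" by (simp add: integrable_indicator_iff flip: less_top)
  have "expectation (\<lambda>\<omega>. A n \<omega> $ k) = expectation (indicat_real ?E)"
    using A_range[OF k] by (intro Bochner_Integration.integral_cong) (auto simp: indicator_def)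
  also have "\<dots> = expectation (real_cond_exp M ?F (indicat_real ?E))"
    using F.real_cond_exp_int(2)[OF \<open>integrable M (indicat_real ?E)\<close>] by simp
  also have "\<dots> = expectation (\<lambda>\<omega>. X n \<omega> $ k)"
    using X_measurable[OF k] action_1[OF k] by (intro integral_cong_AE) auto
  finally show ?thesis .
qed

text \<open>The update is linear in \<open>X n\<close> and \<open>A n\<close>, so taking
  expectations and replacing the means of the actions by \<open>expectation_A\<close> leaves a
  deterministic recursion.\<close>

lemma expectation_X_Suc:
  assumes k: "k < K"
  shows "expectation (\<lambda>\<omega>. X (Suc n) \<omega> $ k) = (1 - \<alpha>) * expectation (\<lambda>\<omega>. X n \<omega> $ k)
    + \<alpha> * (\<Sum>j<K. T $$ (k, j) * expectation (\<lambda>\<omega>. X n \<omega> $ j))"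
proof -
  have "AE \<omega> in M. X (Suc n) \<omega> $ k
      = (1 - \<alpha>) * X n \<omega> $ k + \<alpha> * (\<Sum>j<K. T $$ (k, j) * A n \<omega> $ j)"
    using update[of n]
  proof (rule AE_mp, intro AE_I2 impI)
    fix \<omega> assume "\<omega> \<in> space M"
      and "X (Suc n) \<omega> = (1 - \<alpha>) \<cdot>\<^sub>v X n \<omega> + \<alpha> \<cdot>\<^sub>v (T *\<^sub>v A n \<omega>)"
    then show "X (Suc n) \<omega> $ k
        = (1 - \<alpha>) * X n \<omega> $ k + \<alpha> * (\<Sum>j<K. T $$ (k, j) * A n \<omega> $ j)"
      using X_dim[of \<omega> n] A_dim[of \<omega> n] T(1) k
      by (auto simp: scalar_prod_def atLeast0LessThan)
  qed
  then have "expectation (\<lambda>\<omega>. X (Suc n) \<omega> $ k)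
      = expectation (\<lambda>\<omega>. (1 - \<alpha>) * X n \<omega> $ k + \<alpha> * (\<Sum>j<K. T $$ (k, j) * A n \<omega> $ j))"
    using X_measurable A_measurable k by (intro integral_cong_AE) auto
  also have "\<dots> = (1 - \<alpha>) * expectation (\<lambda>\<omega>. X n \<omega> $ k)
      + \<alpha> * (\<Sum>j<K. T $$ (k, j) * expectation (\<lambda>\<omega>. A n \<omega> $ j))"
    by (subst Bochner_Integration.integral_add)
      (use k integrable_X integrable_A in \<open>auto simp: Bochner_Integration.integral_sum\<close>)
  finally show ?thesis by (simp add: expectation_A)
qed

lemma expectation_X_range:
  assumes "k < K"
  shows "expectation (\<lambda>\<omega>. X n \<omega> $ k) \<in> {0..1}"
  using X_range[OF assms] integrable_X[OF assms]
  by (auto intro!: integral_nonneg_AE AE_I2 integral_le_const)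

lemma X_tendsto_0_in_probability:
  assumes k: "k < K" and lim: "(\<lambda>n. expectation (\<lambda>\<omega>. X n \<omega> $ k)) \<longlonglongrightarrow> 0" and "\<epsilon> > 0"
  shows "(\<lambda>n. prob {\<omega> \<in> space M. X n \<omega> $ k > \<epsilon>}) \<longlonglongrightarrow> 0"
proof (rule tendsto_sandwich[OF _ _ tendsto_const])
  show "(\<lambda>n. expectation (\<lambda>\<omega>. X n \<omega> $ k) / \<epsilon>) \<longlonglongrightarrow> 0"
    using tendsto_divide[OF lim tendsto_const, of \<epsilon>] \<open>\<epsilon> > 0\<close> by simp
  show "\<forall>\<^sub>F n in sequentially. prob {\<omega> \<in> space M. X n \<omega> $ k > \<epsilon>}
      \<le> expectation (\<lambda>\<omega>. X n \<omega> $ k) / \<epsilon>"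
  proof (intro always_eventually allI)
    fix n
    have "{\<omega> \<in> space M. X n \<omega> $ k \<ge> \<epsilon>} \<in> sets M"
      using X_measurable[OF k] by measurable
    \<comment> \<open>Markov's inequality is applied to the event with the non-strict
      inequality.\<close>
    then have "prob {\<omega> \<in> space M. X n \<omega> $ k > \<epsilon>} \<le> prob {\<omega> \<in> space M. X n \<omega> $ k \<ge> \<epsilon>}"
      by (intro finite_measure_mono) auto
    also have "\<dots> \<le> expectation (\<lambda>\<omega>. X n \<omega> $ k) / \<epsilon>"
      using X_range[OF k] \<open>\<epsilon> > 0\<close>
      by (intro integral_Markov_inequality_measure[OF integrable_X[OF k], of "{}"] AE_I2) auto
    finally show "prob {\<omega> \<in> space M. X n \<omega> $ k > \<epsilon>} \<le> expectation (\<lambda>\<omega>. X n \<omega> $ k) / \<epsilon>" .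
  qed
qed simp

end

theorem proposition2:
  fixes M :: "'w measure" and K :: nat and \<alpha> :: real
    and T r Q :: "real mat"
    and X A :: "nat \<Rightarrow> 'w \<Rightarrow> real vec"
  assumes "K \<ge> 2" and "0 < \<alpha>" and "\<alpha> < 1"
    and "T \<in> carrier_mat K K" and "stochastic_mat T"
    and "r \<in> carrier_mat (K - 1) 1" and "Q \<in> carrier_mat (K - 1) (K - 1)"
    and "T = four_block_mat (1\<^sub>m 1) (0\<^sub>m 1 (K - 1)) r Q"
    and "\<exists>i<K - 1. r $$ (i, 0) > 0"
    and "irreducible_mat Q"
    and "random_actions M K \<alpha> T X A"
    and "\<And>n. AE \<omega> in M. X n \<omega> $ 0 = 0"
  shows "\<forall>k<K. \<forall>\<epsilon>>0. (\<lambda>n. measure M {\<omega> \<in> space M. X n \<omega> $ k > \<epsilon>}) \<longlonglongrightarrow> 0"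
proof (intro allI impI)
  fix k and \<epsilon> :: real assume k: "k < K" and \<epsilon>: "\<epsilon> > 0"
  interpret random_actions M K \<alpha> T X A by fact
  define m where "m n k = expectation (\<lambda>\<omega>. X n \<omega> $ k)" for n k
  have "\<exists>l. (\<forall>e>0. \<forall>\<^sub>F n in sequentially. m n j \<le> l + e)
      \<and> (\<forall>v. (\<forall>\<^sub>F n in sequentially. m n j \<le> v) \<longrightarrow> l \<le> v)" if "j < K" for j
    using bounded_upper_limit[of "\<lambda>n. m n j" 0 1] expectation_X_range[OF that]
    unfolding m_def by metis
  \<comment> \<open>The upper limits of the single agents are collected into one function by
    choice.\<close>
  then obtain L where upper: "\<And>j e. j < K \<Longrightarrow> e > 0 \<Longrightarrow> \<forall>\<^sub>F n in sequentially. m n j \<le> L j + e"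
    and least: "\<And>j v. j < K \<Longrightarrow> \<forall>\<^sub>F n in sequentially. m n j \<le> v \<Longrightarrow> L j \<le> v"
    by metis
  have K: "Suc (K - 1) = K" using \<open>K \<ge> 2\<close> by simp
  have t: "\<And>i j. i < K \<Longrightarrow> j < K \<Longrightarrow> 0 \<le> T $$ (i, j)"
    "\<And>i. i < K \<Longrightarrow> (\<Sum>j<K. T $$ (i, j)) = 1"
    using T unfolding stochastic_mat_def by auto
  have sub: "L i \<le> (\<Sum>j<K. T $$ (i, j) * L j)" if "i < K" for i
    by (rule upper_limit_subharmonic[OF alpha that, where m = m])
      (use that t upper least in \<open>auto simp: m_def expectation_X_Suc\<close>)
  have "m n 0 = 0" for n
    using assms(12)[of n] unfolding m_def by (rule integral_eq_zero_AE)
  \<comment> \<open>The stubborn agent has mean 0 at all times, so 0 is an eventual upper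
    bound.\<close>
  then have L0: "L 0 \<le> 0" using K by (intro least) auto
  have "L k \<le> 0"
    by (rule subharmonic_nonpos[OF assms(5-10), unfolded K, OF sub L0 k])
  have "(\<lambda>n. m n k) \<longlonglongrightarrow> 0"
  proof (rule order_tendstoI)
    show "\<forall>\<^sub>F n in sequentially. a < m n k" if "a < 0" for a
      using expectation_X_range[OF k] that by (auto simp: m_def intro!: always_eventually intro: less_le_trans)
    \<comment> \<open>The slack \<open>a / 2\<close> turns the non-strict bound by
      \<open>L k + a / 2\<close> into a strict one by \<open>a\<close>.\<close>
    show "\<forall>\<^sub>F n in sequentially. m n k < a" if "0 < a" for a
      using upper[OF k, of "a / 2"] that \<open>L k \<le> 0\<close> by (auto elim: eventually_mono)
  qed
  then show "(\<lambda>n. prob {\<omega> \<in> space M. X n \<omega> $ k > \<epsilon>}) \<longlonglongrightarrow> 0"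
    unfolding m_def by (rule X_tendsto_0_in_probability[OF k _ \<epsilon>])
qed

end
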